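(* Let $(a_n)_{n\ge 1}$ be a sequence of real numbers with $a_n\ge 0$ such that the Dirichlet series $\sum_{n=1}^\infty a_n/n^z$ converges to $f(z)$ for all complex $z=x+iy$ with $x>1$, and put $s_N=\sum_{n\le N}a_n$. If $$f(x)=\mathcal{O}\{1/(x-1)\}\quad\text{as } x\searrow 1 \ (x \text{ real}),$$ then $$s_N/N=\mathcal{O}(\log N)\quad\text{as } N\to\infty.$$ Moreover, this order-estimate is best possible: there exists a sequence $(a_n)_{n\ge1}$ of real numbers with $a_n\ge 0$, such that the Dirichlet series $\sum_{n=1}^\infty a_n/n^z$ converges to $f(z)$ for all complex $z=x+iy$ with $x>1$ and $f(x)=\mathcal{O}\{1/(x-1)\}$ as $x\searrow 1$ ($x$ real), for which $s_N/N$ is not $o(\log N)$ as $N\to\infty$. *)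

theory Defs
  imports Complex_Main "HOL-Library.Landau_Symbols" "HOL-Analysis.Complex_Transcendental"
begin

text \<open>
  Coefficient sequences are indexed from 1, so the value at index 0 is never used;
  the series is shifted by \<open>Suc\<close> accordingly.
\<close>

definition dirichlet_sums :: "(nat \<Rightarrow> real) \<Rightarrow> complex \<Rightarrow> complex \<Rightarrow> bool" where
  "dirichlet_sums a z l \<longleftrightarrow>
     (\<lambda>n. complex_of_real (a (Suc n)) / of_nat (Suc n) powr z) sums l"

definition partial_sum :: "(nat \<Rightarrow> real) \<Rightarrow> nat \<Rightarrow> real" where
  "partial_sum a N = (\<Sum>n=1..N. a n)"

end

theory Submission
  imports Defs "HOL-Real_Asymp.Real_Asymp"
begin

text \<open>
  Upper bound: since all terms are nonnegative, \<open>s\<^sub>N / N powr x \<le> f x\<close> for \<open>x > 1\<close>, and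
  \<open>x = 1 + 1 / ln N\<close> gives \<open>N powr x = exp 1 * N\<close> and \<open>f x = O(ln N)\<close>.

  Sharpness: put mass \<open>a n = n * log 2 n\<close> on the sparse set of \<open>n = 2 ^ 2 ^ k\<close> only. Then \<open>f x\<close> is
  \<open>\<Sum>k. 2 ^ k * exp (- (2 ^ k * c))\<close> with \<open>c = (x - 1) * ln 2\<close>, twice a lower Riemann sum over a dyadic
  partition for \<open>\<integral> exp (- c * u) du = 1 / c\<close>, whereas \<open>s\<^sub>N / N \<ge> log 2 N\<close> for \<open>N = 2 ^ 2 ^ k\<close>.
\<close>

lemma dirichlet_sums_of_real_iff:
  "dirichlet_sums a (of_real x) l \<longleftrightarrow>
     (\<lambda>n. complex_of_real (a (Suc n) / real (Suc n) powr x)) sums l"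
proof -
  have "of_nat (Suc n) powr complex_of_real x = of_real (real (Suc n) powr x)" for n
    using powr_of_real[of "real (Suc n)" x] by (simp del: of_nat_Suc)
  then show ?thesis
    by (simp add: dirichlet_sums_def del: of_nat_Suc)
qed

text \<open>Rankin's trick: for \<open>n < N\<close> the weight
  \<open>(real N / real (Suc n)) powr x\<close> is at least 1, and the terms of the series from
  index \<open>N\<close> on are nonnegative, so discarding them only lowers the sum.\<close>

lemma partial_sum_le_dirichlet:
  assumes nonneg: "\<And>n. n \<ge> 1 \<Longrightarrow> a n \<ge> 0"
    and sums: "dirichlet_sums a (of_real x) l" and "x \<ge> 0"
  shows "partial_sum a N \<le> real N powr x * norm l"
proof -
  let ?b = "\<lambda>n. a (Suc n) / real (Suc n) powr x"
  have b: "?b sums Re l"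
    using sums_Re[OF sums[unfolded dirichlet_sums_of_real_iff]] by simp
  have "partial_sum a N = (\<Sum>n<N. a (Suc n))"
    unfolding partial_sum_def using sum.atLeast1_atMost_eq by simp
  also have "\<dots> \<le> (\<Sum>n<N. real N powr x * ?b n)"
  proof (rule sum_mono)
    fix n assume "n \<in> {..<N}"
    then have "real (Suc n) powr x \<le> real N powr x"
      using \<open>x \<ge> 0\<close> by (intro powr_mono2) auto
    then have "a (Suc n) * real (Suc n) powr x \<le> a (Suc n) * real N powr x"
      using nonneg[of "Suc n"] by (intro mult_left_mono) auto
    then show "a (Suc n) \<le> real N powr x * ?b n"
      by (simp add: field_simps del: of_nat_Suc)
  qed
  also have "\<dots> = real N powr x * (\<Sum>n<N. ?b n)"
    by (simp add: sum_distrib_left)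
  also have "(\<Sum>n<N. ?b n) \<le> Re l"
    using sum_le_suminf[OF sums_summable[OF b], of "{..<N}"] sums_unique[OF b] nonneg by simp
  also have "Re l \<le> norm l"
    by (rule complex_Re_le_cmod)
  finally show ?thesis
    by (simp add: mult_left_mono)
qed

lemma partial_sum_bigo:
  fixes f :: "complex \<Rightarrow> complex"
  assumes nonneg: "\<And>n. n \<ge> 1 \<Longrightarrow> a n \<ge> 0"
    and sums: "\<And>x. x > 1 \<Longrightarrow> dirichlet_sums a (of_real x) (f (of_real x))"
    and bigo: "(\<lambda>x::real. f (of_real x)) \<in> O[at_right 1](\<lambda>x. complex_of_real (1 / (x - 1)))"
  shows "(\<lambda>N. partial_sum a N / real N) \<in> O(\<lambda>N. ln (real N))"
proof -
  obtain C where "\<forall>\<^sub>F x in at_right 1. norm (f (of_real x)) \<le> C * norm (complex_of_real (1 / (x - 1)))"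
    using bigo by (auto elim: landau_o.bigE)
  \<comment> \<open>The points tend to 1 from the right, so a bound valid for \<open>x\<close> near
    1 turns into one valid for all large \<open>N\<close>.\<close>
  moreover have "filterlim (\<lambda>N. 1 + 1 / ln (real N)) (at_right 1) sequentially"
    by real_asymp
  ultimately have
    "\<forall>\<^sub>F N in sequentially. norm (f (of_real (1 + 1 / ln (real N))))
       \<le> C * norm (complex_of_real (1 / (1 + 1 / ln (real N) - 1)))"
    by (rule eventually_compose_filterlim)
  moreover have "\<forall>\<^sub>F N::nat in sequentially. N \<ge> 2"
    by (rule eventually_ge_at_top)
  ultimately have "\<forall>\<^sub>F N in sequentially.
      norm (partial_sum a N / real N) \<le> (exp 1 * C) * norm (ln (real N))"
  proof eventually_elim
    case (elim N)
    \<comment> \<open>This point minimises \<open>real N powr x / (x - 1)\<close> over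
      \<open>x > 1\<close>, the quantity that bounds the partial sum up to a constant.\<close>
    define x where "x = 1 + 1 / ln (real N)"
    have lnN: "ln (real N) > 0"
      using elim by simp
    then have "x > 1"
      by (simp add: x_def)
    have pos: "partial_sum a N \<ge> 0"
      unfolding partial_sum_def using nonneg by (intro sum_nonneg) auto
    have powr: "real N powr x = exp 1 * real N"
      using elim lnN by (simp add: powr_def x_def algebra_simps exp_add)
    have "partial_sum a N \<le> real N powr x * norm (f (of_real x))"
      using partial_sum_le_dirichlet[OF nonneg sums[OF \<open>x > 1\<close>]] \<open>x > 1\<close> by simp
    also have "\<dots> \<le> (exp 1 * real N) * (C * ln (real N))"
      unfolding powr using elim lnN by (intro mult_left_mono) (auto simp: x_def norm_divide)
    finally show ?case
      using pos elim lnN by (simp add: field_simps)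
  qed
  then show ?thesis
    by (rule bigoI)
qed

lemma dyadic_exp_sum_bounded:
  fixes c :: real
  assumes "c > 0"
  shows "(\<Sum>k<n. 2 ^ k * exp (- (2 ^ k * c))) \<le> 2 / c"
proof -
  \<comment> \<open>The right side is twice the integral of \<open>exp (- c * u)\<close> over the
    interval from \<open>2 ^ k / 2\<close> to \<open>2 ^ k\<close>; the left side is twice the width
    times the value at the right end, where the integrand is least. Consecutive intervals abut, so
    the bounds telescope.\<close>
  have step: "2 ^ k * exp (- (2 ^ k * c)) \<le>
      2 / c * (exp (- (2 ^ k * c / 2)) - exp (- (2 ^ Suc k * c / 2)))" for k :: nat
  proof -
    \<comment> \<open>With \<open>u\<close> equal to \<open>c\<close> times the width, the endpoint
      values are \<open>exp (- u)\<close> and \<open>exp (- 2 * u)\<close>, and the claim reduces to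
      \<open>1 + u \<le> exp u\<close>.\<close>
    define u where "u = 2 ^ k * c / 2"
    have "exp (- 2 * u) * (1 + u) \<le> exp (- 2 * u) * exp u"
      by (intro mult_left_mono exp_ge_add_one_self) auto
    also have "\<dots> = exp (- u)"
      by (simp flip: exp_add)
    finally have "u * exp (- 2 * u) \<le> exp (- u) - exp (- 2 * u)"
      by (simp add: algebra_simps)
    then have "2 / c * (u * exp (- 2 * u)) \<le> 2 / c * (exp (- u) - exp (- 2 * u))"
      using assms by (intro mult_left_mono) auto
    then show ?thesis
      using assms by (simp add: u_def)
  qed
  have "(\<Sum>k<n. 2 ^ k * exp (- (2 ^ k * c))) \<le>
      (\<Sum>k<n. 2 / c * (exp (- (2 ^ k * c / 2)) - exp (- (2 ^ Suc k * c / 2))))"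
    by (intro sum_mono step)
  also have "\<dots> = 2 / c * (exp (- c / 2) - exp (- (2 ^ n * c / 2)))"
    using sum_lessThan_telescope'[of "\<lambda>k. exp (- (2 ^ k * c / 2))" n]
    unfolding sum_distrib_left[symmetric] by simp
  also have "\<dots> \<le> 2 / c * 1"
  proof (intro mult_left_mono)
    have "exp (- c / 2) \<le> 1"
      using assms by simp
    then show "exp (- c / 2) - exp (- (2 ^ n * c / 2)) \<le> 1"
      using exp_gt_zero[of "- (2 ^ n * c / 2)"] by linarith
  qed (use assms in auto)
  finally show ?thesis
    by simp
qed

text \<open>By the upper bound, \<open>n * log 2 n\<close> is the largest order a single coefficient
  can have. The double exponentials place the logarithms \<open>log 2 n = 2 ^ k\<close> of the
  support on a dyadic grid.\<close>

definition sparse_coeff :: "nat \<Rightarrow> real" where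
  "sparse_coeff n = (if n \<in> range (\<lambda>k. 2 ^ 2 ^ k) then real n * log 2 (real n) else 0)"

lemma sparse_coeff_nonneg: "sparse_coeff n \<ge> 0"
  by (auto simp: sparse_coeff_def)

lemma sparse_coeff_double_power: "sparse_coeff (2 ^ 2 ^ k) = 2 ^ 2 ^ k * 2 ^ k"
  by (auto simp: sparse_coeff_def log_nat_power)

text \<open>The norm of each term depends on \<open>z\<close> only through \<open>Re z\<close>, so
  the real estimate gives absolute convergence on the whole half-plane together with the
  bound.\<close>

lemma sparse_dirichlet:
  assumes "Re z > 1"
  shows "\<exists>l. dirichlet_sums sparse_coeff z l \<and> norm l \<le> 2 / ((Re z - 1) * ln 2)"
proof -
  define c where "c = (Re z - 1) * ln 2"
  have "c > 0"
    using assms by (simp add: c_def)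
  define t where "t n = complex_of_real (sparse_coeff (Suc n)) / of_nat (Suc n) powr z" for n
  \<comment> \<open>Position of the \<open>k\<close>-th nonzero term; the subtraction undoes the
    shift by \<open>Suc\<close> and never truncates.\<close>
  define g :: "nat \<Rightarrow> nat" where "g k = 2 ^ 2 ^ k - 1" for k
  have Suc_g: "Suc (g k) = 2 ^ 2 ^ k" for k
    by (simp add: g_def)
  have "strict_mono g"
  proof (rule strict_monoI)
    fix i j :: nat assume "i < j"
    then have "Suc (g i) < Suc (g j)"
      unfolding Suc_g by simp
    then show "g i < g j"
      by simp
  qed
  have zero: "t n = 0" if "n \<notin> range g" for n
  proof -
    have "Suc n \<notin> range (\<lambda>k. 2 ^ 2 ^ k)"
      using that by (auto simp flip: Suc_g)
    then show ?thesis
      by (simp add: t_def sparse_coeff_def del: of_nat_Suc)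
  qed
  have norm_t: "norm (t (g k)) = 2 ^ k * exp (- (2 ^ k * c))" for k
  proof -
    have "norm (of_nat (2 ^ 2 ^ k) powr z) = real (2 ^ 2 ^ k) powr Re z"
      using norm_powr_real_powr[of "of_nat (2 ^ 2 ^ k)" z] by simp
    also have "\<dots> = exp (2 ^ k * ln 2 * Re z)"
      by (simp add: powr_def ln_realpow mult_ac)
    finally have "norm (t (g k)) = 2 ^ 2 ^ k * 2 ^ k / exp (2 ^ k * ln 2 * Re z)"
      unfolding t_def Suc_g sparse_coeff_double_power norm_divide by (simp add: norm_mult norm_power)
    also have "(2::real) ^ 2 ^ k = exp (2 ^ k * ln 2)"
      using exp_of_nat_mult[of "2 ^ k" "ln (2::real)"] by simp
    also have "exp (2 ^ k * ln 2) * 2 ^ k / exp (2 ^ k * ln 2 * Re z)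
        = 2 ^ k * exp (2 ^ k * ln 2 - 2 ^ k * ln 2 * Re z)"
      by (simp add: exp_diff)
    also have "2 ^ k * ln 2 - 2 ^ k * ln 2 * Re z = - (2 ^ k * c)"
      by (simp add: c_def algebra_simps)
    finally show ?thesis .
  qed
  have bound: "(\<Sum>k<n. norm (t (g k))) \<le> 2 / c" for n
    unfolding norm_t by (rule dyadic_exp_sum_bounded[OF \<open>c > 0\<close>])
  have summable: "summable (\<lambda>k. norm (t (g k)))"
    by (rule summableI_nonneg_bounded[OF _ bound]) simp
  have "(\<lambda>k. t (g k)) sums (\<Sum>k. t (g k))"
    by (rule summable_sums[OF summable_norm_cancel[OF summable]])
  \<comment> \<open>\<open>t\<close> vanishes off the range of the strictly increasing
    \<open>g\<close>, so the full series and the subseries have the same sum.\<close>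
  then have "t sums (\<Sum>k. t (g k))"
    using sums_mono_reindex[OF \<open>strict_mono g\<close>, of t] zero by auto
  moreover have "norm (\<Sum>k. t (g k)) \<le> 2 / c"
    using summable_norm[OF summable] suminf_le_const[OF summable bound] by (rule order_trans)
  ultimately show ?thesis
    unfolding dirichlet_sums_def t_def c_def by blast
qed

lemma partial_sum_sparse_ge: "partial_sum sparse_coeff (2 ^ 2 ^ k) \<ge> 2 ^ 2 ^ k * 2 ^ k"
proof -
  have "sparse_coeff (2 ^ 2 ^ k) \<le> partial_sum sparse_coeff (2 ^ 2 ^ k)"
    unfolding partial_sum_def by (rule member_le_sum) (auto simp: sparse_coeff_nonneg)
  then show ?thesis
    by (simp only: sparse_coeff_double_power)
qed

lemma partial_sum_sparse_not_smallo:
  "(\<lambda>N. partial_sum sparse_coeff N / real N) \<notin> o(\<lambda>N. ln (real N))"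
proof
  assume "(\<lambda>N. partial_sum sparse_coeff N / real N) \<in> o(\<lambda>N. ln (real N))"
  \<comment> \<open>The constant 1 already leads to a contradiction: along
    \<open>N = 2 ^ 2 ^ k\<close> the quotient is at least \<open>2 ^ k\<close>, while
    \<open>ln N = 2 ^ k * ln 2\<close> with \<open>ln 2 < 1\<close>.\<close>
  then have "\<forall>\<^sub>F N in sequentially.
      norm (partial_sum sparse_coeff N / real N) \<le> 1 * norm (ln (real N))"
    by (rule landau_o.smallD) simp
  then obtain M where M: "\<And>N. N \<ge> M \<Longrightarrow>
      norm (partial_sum sparse_coeff N / real N) \<le> norm (ln (real N))"
    by (auto simp: eventually_sequentially)
  have "M < 2 ^ 2 ^ M"
    by (meson less_exp less_trans)
  then have "norm (partial_sum sparse_coeff (2 ^ 2 ^ M) / real (2 ^ 2 ^ M))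
      \<le> norm (ln (real (2 ^ 2 ^ M)))"
    by (intro M) simp
  also have "norm (ln (real (2 ^ 2 ^ M))) = 2 ^ M * ln 2"
    by (simp add: ln_realpow)
  also have "\<dots> < 2 ^ M * 1"
    using ln_2_less_1 by (intro mult_strict_left_mono) auto
  finally have "\<bar>partial_sum sparse_coeff (2 ^ 2 ^ M)\<bar> / 2 ^ 2 ^ M < 2 ^ M"
    by simp
  then show False
    using partial_sum_sparse_ge[of M] by (simp add: field_simps)
qed

theorem proposition1p2:
  shows "(\<forall>(a :: nat \<Rightarrow> real) (f :: complex \<Rightarrow> complex).
            (\<forall>n\<ge>1. a n \<ge> 0) \<longrightarrow>
            (\<forall>z. Re z > 1 \<longrightarrow> dirichlet_sums a z (f z)) \<longrightarrow>
            (\<lambda>x::real. f (complex_of_real x)) \<in> O[at_right 1](\<lambda>x. complex_of_real (1 / (x - 1))) \<longrightarrow>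
            (\<lambda>N. partial_sum a N / real N) \<in> O[sequentially](\<lambda>N. ln (real N)))
       \<and> (\<exists>(a :: nat \<Rightarrow> real) (f :: complex \<Rightarrow> complex).
            (\<forall>n\<ge>1. a n \<ge> 0) \<and>
            (\<forall>z. Re z > 1 \<longrightarrow> dirichlet_sums a z (f z)) \<and>
            (\<lambda>x::real. f (complex_of_real x)) \<in> O[at_right 1](\<lambda>x. complex_of_real (1 / (x - 1))) \<and>
            (\<lambda>N. partial_sum a N / real N) \<notin> o[sequentially](\<lambda>N. ln (real N)))"
proof (intro conjI allI impI)
  fix a :: "nat \<Rightarrow> real" and f :: "complex \<Rightarrow> complex"
  assume "\<forall>n\<ge>1. a n \<ge> 0" "\<forall>z. Re z > 1 \<longrightarrow> dirichlet_sums a z (f z)"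
    and "(\<lambda>x::real. f (complex_of_real x)) \<in> O[at_right 1](\<lambda>x. complex_of_real (1 / (x - 1)))"
  then show "(\<lambda>N. partial_sum a N / real N) \<in> O(\<lambda>N. ln (real N))"
    by (intro partial_sum_bigo[of a f]) auto
next
  \<comment> \<open>A choice of the sum at each \<open>z\<close> in the half-plane; at real
    \<open>x\<close> its norm bound yields the constant \<open>2 / ln 2\<close> for the order
    estimate.\<close>
  obtain f where f: "\<And>z. Re z > 1 \<Longrightarrow>
      dirichlet_sums sparse_coeff z (f z) \<and> norm (f z) \<le> 2 / ((Re z - 1) * ln 2)"
    using sparse_dirichlet by metis
  have "\<forall>\<^sub>F x in at_right (1::real). x > 1"
    by (rule eventually_at_right_less)
  then have "\<forall>\<^sub>F x in at_right 1.
      norm (f (complex_of_real x)) \<le> 2 / ln 2 * norm (complex_of_real (1 / (x - 1)))"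
  proof eventually_elim
    case (elim x)
    then have "norm (complex_of_real (1 / (x - 1))) = 1 / (x - 1)"
      unfolding norm_of_real by simp
    then show ?case
      using f[of "of_real x"] elim by (simp add: mult.commute)
  qed
  then have "(\<lambda>x::real. f (complex_of_real x)) \<in> O[at_right 1](\<lambda>x. complex_of_real (1 / (x - 1)))"
    by (rule bigoI)
  then show "\<exists>(a :: nat \<Rightarrow> real) (f :: complex \<Rightarrow> complex).
            (\<forall>n\<ge>1. a n \<ge> 0) \<and>
            (\<forall>z. Re z > 1 \<longrightarrow> dirichlet_sums a z (f z)) \<and>
            (\<lambda>x::real. f (complex_of_real x)) \<in> O[at_right 1](\<lambda>x. complex_of_real (1 / (x - 1))) \<and>
            (\<lambda>N. partial_sum a N / real N) \<notin> o[sequentially](\<lambda>N. ln (real N))"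
    using f sparse_coeff_nonneg partial_sum_sparse_not_smallo
    by (intro exI[of _ sparse_coeff] exI[of _ f]) auto
qed

end
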